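(* Let $n$ be a positive odd integer, let $m=(n-1)/2$, and let $\mathbf{M}$ be a harmonic $n\times n$ matrix, with entries $M_{i,j}=\alpha ij+\beta i+\gamma j+\delta$ for $0\le i,j\le n-1$, where $\alpha,\beta,\gamma,\delta$ are real constants. Let $k$ be an integer with $1\le k\le m$, and let $C_k$ be the set of index pairs forming the union of the four sides of the square at distance $k$ from $(m,m)$. Then $$\frac{1}{8k}\sum_{(i,j)\in C_k}M_{i,j}=\alpha m^2+\beta m+\gamma m+\delta=M_{m,m}.$$
   Context: Rows and columns of an $n\times n$ matrix are indexed by $0,1,\dots,n-1$. An $n\times n$ matrix $\mathbf{M}$ is called harmonic if there exist real constants $\alpha,\beta,\gamma,\delta$ such that $M_{i,j}=\alpha\,ij+\beta\,i+\gamma\,j+\delta$ for all $0\le i,j\le n-1$. For $1\le k\le m$, $C_k=C_{k,1}\cup C_{k,2}\cup C_{k,3}\cup C_{k,4}$, where $C_{k,1}=\{(m-k+r,\,m-k): 0\le r\le 2k-1\}$, $C_{k,2}=\{(m+k,\,m-k+r): 0\le r\le 2k-1\}$, $C_{k,3}=\{(m+k-r,\,m+k): 0\le r\le 2k-1\}$, $C_{k,4}=\{(m-k,\,m+k-r): 0\le r\le 2k-1\}$, with $r$ ranging over integers; thus $|C_k|=8k$. *)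

theory Defs
  imports Complex_Main "Jordan_Normal_Form.Matrix"
begin

definition harmonic_mat :: "nat \<Rightarrow> real mat \<Rightarrow> bool" where
  "harmonic_mat n M \<longleftrightarrow> M \<in> carrier_mat n n \<and>
    (\<exists>\<alpha> \<beta> \<gamma> \<delta> :: real. \<forall>i<n. \<forall>j<n.
       M $$ (i, j) = \<alpha> * real i * real j + \<beta> * real i + \<gamma> * real j + \<delta>)"

(* Each side of the square omits its final corner, so the four sides are disjoint.
   No subtraction below truncates when 1 \<le> k \<le> m. *)

definition side1 :: "nat \<Rightarrow> nat \<Rightarrow> (nat \<times> nat) set" where
  "side1 m k = {(m - k + r, m - k) | r. r \<le> 2 * k - 1}"

definition side2 :: "nat \<Rightarrow> nat \<Rightarrow> (nat \<times> nat) set" where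
  "side2 m k = {(m + k, m - k + r) | r. r \<le> 2 * k - 1}"

definition side3 :: "nat \<Rightarrow> nat \<Rightarrow> (nat \<times> nat) set" where
  "side3 m k = {(m + k - r, m + k) | r. r \<le> 2 * k - 1}"

definition side4 :: "nat \<Rightarrow> nat \<Rightarrow> (nat \<times> nat) set" where
  "side4 m k = {(m - k, m + k - r) | r. r \<le> 2 * k - 1}"

definition concentric_square :: "nat \<Rightarrow> nat \<Rightarrow> (nat \<times> nat) set" where
  "concentric_square m k = side1 m k \<union> side2 m k \<union> side3 m k \<union> side4 m k"

end

theory Submission
  imports Defs
begin

text \<open>
  The square \<open>concentric_square m k\<close> is invariant under the rotation by a quarter turn about
  its centre \<open>(m, m)\<close>. This rotation carries each of the four sides onto the next one, and
  it matches the points with the same parameter \<open>r\<close>: with \<open>t = r - k\<close>, the displacements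
  of these points from the centre are \<open>(t, -k)\<close>, \<open>(k, t)\<close>, \<open>(-t, k)\<close> and \<open>(-k, -t)\<close>. So the
  square is the disjoint union of \<open>2 k\<close> rotation orbits with four points each
  (\<open>sum_concentric_square\<close>).

  On a single orbit, the mean of \<open>\<alpha> x y + \<beta> x + \<gamma> y + \<delta>\<close> is already its value at the centre
  (\<open>sum_quarter_turn_orbit\<close>): the displacements add up to zero, which removes the linear
  terms, and their coordinate products are \<open>-tk, kt, -tk, kt\<close>, because a quarter turn
  reverses the sign of the product of the coordinates. Adding the \<open>2 k\<close> orbits gives
  \<open>8 k\<close> times the value at the centre.
\<close>

lemma sum_quarter_turn_orbit:
  fixes \<alpha> \<beta> \<gamma> \<delta> a b s t :: "'a :: comm_ring_1"
  defines "q \<equiv> \<lambda>x y. \<alpha> * x * y + \<beta> * x + \<gamma> * y + \<delta>"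
  shows "q (a + t) (b - s) + q (a + s) (b + t) + q (a - t) (b + s) + q (a - s) (b - t)
           = 4 * q a b"
  unfolding q_def by (simp add: algebra_simps)

text \<open>
  Each side leaves out its final corner, which is the first point of the next side, so every
  point of the square is counted exactly once. For \<open>k = 0\<close> the four sides would all consist
  of the centre alone, while the right-hand side is empty.
\<close>

lemma sum_concentric_square:
  fixes f :: "nat \<times> nat \<Rightarrow> 'a :: comm_monoid_add"
  assumes "1 \<le> k" and "k \<le> m"
  shows "sum f (concentric_square m k) =
    (\<Sum>r<2 * k. f (m - k + r, m - k) + f (m + k, m - k + r)
              + f (m + k - r, m + k) + f (m - k, m + k - r))"
proof -
  have bound: "{r. r \<le> 2 * k - 1} = {..<2 * k}"
    using assms(1) by auto
  have sides:
    "side1 m k = (\<lambda>r. (m - k + r, m - k)) ` {..<2 * k}"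
    "side2 m k = (\<lambda>r. (m + k, m - k + r)) ` {..<2 * k}"
    "side3 m k = (\<lambda>r. (m + k - r, m + k)) ` {..<2 * k}"
    "side4 m k = (\<lambda>r. (m - k, m + k - r)) ` {..<2 * k}"
    unfolding side1_def side2_def side3_def side4_def setcompr_eq_image bound by simp_all
  have finite: "finite (side1 m k)" "finite (side2 m k)" "finite (side3 m k)" "finite (side4 m k)"
    unfolding sides by simp_all
  have disjoint:
    "side1 m k \<inter> side2 m k = {}"
    "(side1 m k \<union> side2 m k) \<inter> side3 m k = {}"
    "(side1 m k \<union> side2 m k \<union> side3 m k) \<inter> side4 m k = {}"
    unfolding sides using assms by auto
  \<comment> \<open>On sides 3 and 4 the truncated difference \<open>m + k - r\<close> is injective in \<open>r\<close>
      on the range of summation, where \<open>r < 2 * k \<le> m + k\<close>.\<close>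
  have side_sums:
    "sum f (side1 m k) = (\<Sum>r<2 * k. f (m - k + r, m - k))"
    "sum f (side2 m k) = (\<Sum>r<2 * k. f (m + k, m - k + r))"
    "sum f (side3 m k) = (\<Sum>r<2 * k. f (m + k - r, m + k))"
    "sum f (side4 m k) = (\<Sum>r<2 * k. f (m - k, m + k - r))"
    unfolding sides using assms by (subst sum.reindex; auto simp: inj_on_def)+
  show ?thesis
    unfolding concentric_square_def
    by (simp add: sum.union_disjoint finite disjoint side_sums sum.distrib)
qed

theorem theorem4:
  fixes n m k :: nat and M :: "real mat" and \<alpha> \<beta> \<gamma> \<delta> :: real
  assumes "0 < n" and "odd n"
    and "m = (n - 1) div 2"
    and "harmonic_mat n M"
    and "\<And>i j. i < n \<Longrightarrow> j < n \<Longrightarrow>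
           M $$ (i, j) = \<alpha> * real i * real j + \<beta> * real i + \<gamma> * real j + \<delta>"
    and "1 \<le> k" and "k \<le> m"
  shows "1 / (8 * real k) * (\<Sum>(i, j)\<in>concentric_square m k. M $$ (i, j))
           = \<alpha> * (real m)\<^sup>2 + \<beta> * real m + \<gamma> * real m + \<delta>
       \<and> \<alpha> * (real m)\<^sup>2 + \<beta> * real m + \<gamma> * real m + \<delta> = M $$ (m, m)"
proof -
  define c where "c = \<alpha> * (real m)\<^sup>2 + \<beta> * real m + \<gamma> * real m + \<delta>"
  have n: "n = 2 * m + 1"
    using assms(2,3) by (auto elim: oddE)
  have centre: "M $$ (m, m) = c"
    using assms(5)[of m m] n by (simp add: c_def power2_eq_square)
  have orbit: "M $$ (m - k + r, m - k) + M $$ (m + k, m - k + r)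
                 + M $$ (m + k - r, m + k) + M $$ (m - k, m + k - r) = 4 * c"
    if "r < 2 * k" for r
  proof -
    let ?t = "real r - real k"
    have coords: "real (m - k + r) = real m + ?t" "real (m + k - r) = real m - ?t"
        "real (m - k) = real m - real k" "real (m + k) = real m + real k"
      using that \<open>k \<le> m\<close> by (simp_all add: of_nat_diff)
    have range: "m - k + r < n" "m + k - r < n" "m - k < n" "m + k < n"
      using that \<open>k \<le> m\<close> n by linarith+
    show ?thesis
      using sum_quarter_turn_orbit[of \<alpha> "real m" ?t "real m" "real k" \<beta> \<gamma> \<delta>]
      by (simp only: assms(5) range coords c_def power2_eq_square mult.assoc)
  qed
  have "(\<Sum>(i, j)\<in>concentric_square m k. M $$ (i, j)) =
      (\<Sum>r<2 * k. M $$ (m - k + r, m - k) + M $$ (m + k, m - k + r)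
                + M $$ (m + k - r, m + k) + M $$ (m - k, m + k - r))"
    by (simp only: sum_concentric_square[OF assms(6,7)] prod.case)
  also have "\<dots> = (\<Sum>r<2 * k. 4 * c)"
    by (intro sum.cong refl orbit) simp
  also have "\<dots> = 8 * real k * c"
    by simp
  finally show ?thesis
    using \<open>1 \<le> k\<close> centre by (simp add: c_def)
qed

end
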